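(* Let $n$ be a square-free positive integer and let $p>n$ be a prime. Suppose that $\mathrm{S\text{-}T}(\mathbb{Z}_n)$ holds, i.e. every spectral subset of $\mathbb{Z}_n$ tiles $\mathbb{Z}_n$. Then $\mathrm{S\text{-}T}(\mathbb{Z}_n\times\mathbb{Z}_p)$ holds, i.e. every spectral subset of $\mathbb{Z}_n\times\mathbb{Z}_p$ tiles $\mathbb{Z}_n\times\mathbb{Z}_p$.
   Context: $\mathbb{Z}_N$ denotes the cyclic group of order $N$, and its dual group is identified with $\mathbb{Z}_N$ via $\lambda\mapsto\left(x\mapsto e^{2\pi i\lambda x/N}\right)$. Since $\gcd(n,p)=1$, the group $\mathbb{Z}_n\times\mathbb{Z}_p$ is identified with $\mathbb{Z}_{np}$ by the Chinese remainder theorem. A non-empty set $A\subseteq\mathbb{Z}_N$ is spectral if there is a set $\Lambda\subseteq\mathbb{Z}_N$ with $|\Lambda|=|A|$ such that $\sum_{a\in A}e^{2\pi i(\lambda-\lambda')a/N}=0$ for all distinct $\lambda,\lambda'\in\Lambda$; such a $\Lambda$ is called a spectrum of $A$. A subset $A$ of a finite abelian group $G$ tiles $G$ if there is $B\subseteq G$ such that every element of $G$ has a unique representation as $a+b$ with $a\in A$, $b\in B$. For a finite abelian group $G$, $\mathrm{S\text{-}T}(G)$ denotes the assertion that every spectral subset of $G$ tiles $G$. *)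

theory Defs
  imports
    Complex_Main
    "HOL-Algebra.Elementary_Groups"
    "HOL-Computational_Algebra.Squarefree"
begin

abbreviation cyclic :: "nat \<Rightarrow> int monoid" where
  "cyclic N \<equiv> integer_mod_group N"

text \<open>\<open>is_spectrum N A L\<close> is the condition on a spectrum of a subset \<open>A\<close> of the cyclic group
  of order \<open>N\<close>. The difference \<open>l - l'\<close> is taken in the integers: the exponential
  depends only on its residue modulo \<open>N\<close>.\<close>

definition is_spectrum :: "nat \<Rightarrow> int set \<Rightarrow> int set \<Rightarrow> bool" where
  "is_spectrum N A L \<longleftrightarrow>
     L \<subseteq> carrier (cyclic N) \<and> card L = card A \<and>
     (\<forall>l\<in>L. \<forall>l'\<in>L. l \<noteq> l' \<longrightarrow>
        (\<Sum>a\<in>A. exp (2 * of_real pi * \<i> * of_int (l - l') * of_int a / of_nat N)) = (0::complex))"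

definition spectral :: "nat \<Rightarrow> int set \<Rightarrow> bool" where
  "spectral N A \<longleftrightarrow> A \<noteq> {} \<and> A \<subseteq> carrier (cyclic N) \<and> (\<exists>L. is_spectrum N A L)"

definition crt :: "nat \<Rightarrow> nat \<Rightarrow> int \<Rightarrow> int \<times> int" where
  "crt m k x = (x mod int m, x mod int k)"

lemma crt_iso:
  assumes "coprime m k" and "m > 0" and "k > 0"
  shows "crt m k \<in> iso (cyclic (m * k)) (cyclic m \<times>\<times> cyclic k)"
proof -
  have inj: "inj_on (crt m k) {0..<int (m * k)}"
  proof (rule inj_onI)
    fix x y
    assume xy: "x \<in> {0..<int (m * k)}" "y \<in> {0..<int (m * k)}" "crt m k x = crt m k y"
    then have "int m dvd x - y" "int k dvd x - y"
      by (auto simp: crt_def mod_eq_dvd_iff)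
    then have "int m * int k dvd x - y"
      using assms(1) by (simp add: divides_mult)
    then have "x mod int (m * k) = y mod int (m * k)"
      by (simp add: mod_eq_dvd_iff)
    then show "x = y" using xy by simp
  qed
  have sub: "crt m k ` {0..<int (m * k)} \<subseteq> {0..<int m} \<times> {0..<int k}"
    using assms by (auto simp: crt_def)
  have "card (crt m k ` {0..<int (m * k)}) = m * k"
    using card_image[OF inj] by (simp add: nat_mult_distrib)
  then have "crt m k ` {0..<int (m * k)} = {0..<int m} \<times> {0..<int k}"
    by (intro card_subset_eq[OF _ sub]) (simp_all add: card_cartesian_product)
  with inj have "bij_betw (crt m k) {0..<int (m * k)} ({0..<int m} \<times> {0..<int k})"
    by (simp add: bij_betw_def)
  moreover have "crt m k ((x + y) mod int (m * k)) =
      crt m k x \<otimes>\<^bsub>cyclic m \<times>\<times> cyclic k\<^esub> crt m k y" for x y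
    by (simp add: crt_def mod_mod_cancel mod_add_eq)
  ultimately show ?thesis
    using assms sub
    by (auto simp: iso_def hom_def carrier_integer_mod_group Pi_iff)
qed

text \<open>Spectrality in a product of two cyclic groups of coprime orders \<open>m\<close> and \<open>k\<close>: the product is
  identified with the cyclic group of order \<open>m * k\<close> by \<open>crt_iso\<close>, so that a subset corresponds to
  its preimage under \<open>crt m k\<close>. Only meaningful for coprime \<open>m\<close> and \<open>k\<close>.\<close>

definition spectral_prod :: "nat \<Rightarrow> nat \<Rightarrow> (int \<times> int) set \<Rightarrow> bool" where
  "spectral_prod m k A \<longleftrightarrow>
     A \<subseteq> carrier (cyclic m \<times>\<times> cyclic k) \<and>
     spectral (m * k) {x \<in> carrier (cyclic (m * k)). crt m k x \<in> A}"

definition tiles :: "('a, 'b) monoid_scheme \<Rightarrow> 'a set \<Rightarrow> bool" where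
  "tiles G A \<longleftrightarrow>
     A \<subseteq> carrier G \<and>
     (\<exists>B. B \<subseteq> carrier G \<and>
        (\<forall>g\<in>carrier G. \<exists>!z. z \<in> A \<times> B \<and> g = fst z \<otimes>\<^bsub>G\<^esub> snd z))"

text \<open>The parameter \<open>spec\<close> is the spectrality predicate for subsets of \<open>G\<close>:
  \<open>spectral N\<close> for \<open>cyclic N\<close>, and \<open>spectral_prod m k\<close> for \<open>cyclic m \<times>\<times> cyclic k\<close>.\<close>

definition S_T :: "('a, 'b) monoid_scheme \<Rightarrow> ('a set \<Rightarrow> bool) \<Rightarrow> bool" where
  "S_T G spec \<longleftrightarrow> (\<forall>A. A \<subseteq> carrier G \<longrightarrow> spec A \<longrightarrow> tiles G A)"

end

theory Submission
  imports
    Defs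
    "HOL-Computational_Algebra.Polynomial_Factorial"
    "HOL-Number_Theory.Cong"
begin

text \<open>Let \<open>L\<close> be a spectrum of \<open>A \<subseteq> \<int>\<^sub>n \<times> \<int>\<^sub>p\<close>. As \<open>n\<close> and \<open>p\<close> are coprime, Galois conjugation shows
  that a zero of the Fourier transform of \<open>A\<close> at a frequency with non-zero \<open>\<int>\<^sub>p\<close>-component forces
  all \<open>p\<close> sections \<open>A\<^sub>t \<subseteq> \<int>\<^sub>n\<close> to have the same Fourier coefficient at the \<open>\<int>\<^sub>n\<close>-component.

  If \<open>|A| < p\<close>, some section is empty, so these coefficients vanish; then the projections of \<open>A\<close>
  and \<open>L\<close> to \<open>\<int>\<^sub>n\<close> are injective and form a spectral pair, and a tiling complement \<open>B\<close> of the
  projection yields the complement \<open>B \<times> \<int>\<^sub>p\<close> of \<open>A\<close>.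

  If \<open>|A| \<ge> p > n\<close>, two points of \<open>L\<close> agree in \<open>\<int>\<^sub>n\<close>, hence all \<open>A\<^sub>t\<close> have the same size \<open>m\<close>, and
  dually all sections of \<open>L\<close> have size \<open>m\<close>. At most \<open>n < p\<close> points of \<open>L\<close> are alone above their
  \<open>\<int>\<^sub>n\<close>-component, so some section \<open>L\<^sub>k\<close> contains no such point; it is a spectrum of every \<open>A\<^sub>t\<close>.
  Thus every \<open>A\<^sub>t\<close> tiles \<open>\<int>\<^sub>n\<close>, and since \<open>n\<close> is square-free, Tijdeman's theorem allows one
  complement for all of them, the subgroup of order \<open>n / m\<close>.\<close>

subsection \<open>Integer polynomials at roots of unity\<close>

lemma prime_add_power:
  fixes x y :: "'a::comm_ring_1"
  assumes "Factorial_Ring.prime q"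
  shows "\<exists>c. (x + y) ^ q = x ^ q + y ^ q + of_nat q * c"
proof -
  have q: "q \<noteq> 0" using assms by auto
  have set: "{..q} = insert 0 (insert q {0<..<q})" by auto
  have "(x + y) ^ q = (\<Sum>k\<le>q. of_nat (q choose k) * x ^ k * y ^ (q - k))"
    by (rule binomial_ring)
  also have "\<dots> = x ^ q + y ^ q + (\<Sum>k\<in>{0<..<q}. of_nat (q choose k) * x ^ k * y ^ (q - k))"
    using q by (subst set) simp
  also have "(\<Sum>k\<in>{0<..<q}. of_nat (q choose k) * x ^ k * y ^ (q - k))
      = (\<Sum>k\<in>{0<..<q}. of_nat q * (of_nat ((q choose k) div q) * x ^ k * y ^ (q - k)))"
  proof (rule sum.cong[OF refl])
    fix k assume "k \<in> {0<..<q}"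
    then have "q dvd q choose k" by (intro dvd_choose_prime) (use assms in auto)
    then have "q choose k = q * ((q choose k) div q)" by simp
    then have "of_nat (q choose k) = (of_nat q * of_nat ((q choose k) div q) :: 'a)"
      by (metis of_nat_mult)
    then show "of_nat (q choose k) * x ^ k * y ^ (q - k)
        = (of_nat q * (of_nat ((q choose k) div q) * x ^ k * y ^ (q - k)) :: 'a)"
      by (simp add: mult.assoc)
  qed
  finally show ?thesis unfolding sum_distrib_left[symmetric] by blast
qed

lemma int_power_prime:
  fixes a :: int
  assumes "Factorial_Ring.prime q"
  shows "int q dvd a ^ q - a"
proof (induction a rule: int_induct[where k = 0])
  case base
  then show ?case using assms by (auto simp: power_0_left)
next
  case (step1 i)
  obtain c where "(i + 1) ^ q = i ^ q + 1 ^ q + int q * c"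
    using prime_add_power[OF assms, of i 1] by auto
  then have "(i + 1) ^ q - (i + 1) = i ^ q - i + int q * c" by simp
  then show ?case using step1 by (metis dvd_add dvd_triv_left)
next
  case (step2 i)
  obtain c where "(i - 1 + 1) ^ q = (i - 1) ^ q + 1 ^ q + int q * c"
    using prime_add_power[OF assms, of "i - 1" 1] by auto
  then have "(i - 1) ^ q - (i - 1) = (i ^ q - i) - int q * c" by simp
  then show ?case using step2 by (metis dvd_diff dvd_triv_left)
qed

text \<open>Frobenius modulo \<open>q\<close> with an explicit error polynomial, which can later be
  evaluated at complex numbers. The induction splits off the constant coefficient, where Fermat's
  congruence \<open>int_power_prime\<close> applies.\<close>

lemma pcompose_monom_prime:
  fixes f :: "int poly"
  assumes "Factorial_Ring.prime q"
  shows "\<exists>w. pcompose f (monom 1 q) = f ^ q + smult (int q) w"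
proof (induction f)
  case 0
  then show ?case using assms by (intro exI[of _ 0]) (simp add: prime_gt_0_nat)
next
  case (pCons a f)
  then obtain w where w: "pcompose f (monom 1 q) = f ^ q + smult (int q) w" by blast
  let ?X = "monom 1 1 :: int poly"
  have eq: "pCons a f = [:a:] + ?X * f" by (simp add: monom_altdef)
  obtain c where "([:a:] + ?X * f) ^ q = [:a:] ^ q + (?X * f) ^ q + of_nat q * c"
    using prime_add_power[OF assms] by blast
  then have c: "(pCons a f) ^ q = [:a ^ q:] + monom 1 q * f ^ q + smult (int q) c"
    unfolding eq by (simp add: power_mult_distrib monom_power poly_const_pow of_nat_poly)
  obtain b where b: "a ^ q = a + int q * b"
    using int_power_prime[OF assms, of a] by (metis dvdE diff_eq_eq add.commute)
  have "pcompose (pCons a f) (monom 1 q) = [:a:] + monom 1 q * (f ^ q + smult (int q) w)"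
    using w by (simp add: pcompose_pCons)
  also have "\<dots> = (pCons a f) ^ q + smult (int q) (monom 1 q * w - c - [:b:])"
    unfolding c b by (simp add: algebra_simps smult_diff_right smult_add_right)
  finally show ?case by blast
qed

section \<open>The ring Z[z] as values of integer polynomials\<close>

definition ieval :: "int poly \<Rightarrow> complex \<Rightarrow> complex" where
  "ieval f z = poly (map_poly of_int f) z"

lemma ieval_0 [simp]: "ieval 0 z = 0"
  by (simp add: ieval_def)

lemma ieval_pCons [simp]: "ieval (pCons a f) z = of_int a + z * ieval f z"
  by (simp add: ieval_def map_poly_pCons)

lemma ieval_1 [simp]: "ieval 1 z = 1"
  by (simp add: one_pCons)

lemma ieval_add [simp]: "ieval (f + g) z = ieval f z + ieval g z"
  by (induction f g rule: poly_induct2) (simp_all add: algebra_simps)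

lemma ieval_smult [simp]: "ieval (smult a f) z = of_int a * ieval f z"
  by (induction f) (simp_all add: algebra_simps)

lemma ieval_uminus [simp]: "ieval (- f) z = - ieval f z"
  using ieval_smult[of "-1" f z] by simp

lemma ieval_diff [simp]: "ieval (f - g) z = ieval f z - ieval g z"
  using ieval_add[of f "- g" z] by simp

lemma ieval_mult [simp]: "ieval (f * g) z = ieval f z * ieval g z"
  by (induction f) (simp_all add: algebra_simps)

lemma ieval_power [simp]: "ieval (f ^ k) z = ieval f z ^ k"
  by (induction k) simp_all

lemma ieval_monom [simp]: "ieval (monom a k) z = of_int a * z ^ k"
  by (induction k) (simp_all add: monom_0 monom_Suc)

lemma ieval_sum [simp]: "ieval (\<Sum>x\<in>S. f x) z = (\<Sum>x\<in>S. ieval (f x) z)"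
  by (induction S rule: infinite_finite_induct) simp_all

lemma ieval_pcompose [simp]: "ieval (pcompose f g) z = ieval f (ieval g z)"
  by (induction f) (simp_all add: pcompose_pCons)

text \<open>Take a non-zero annihilator of least degree and make it primitive. Gauss's lemma
  upgrades pseudo-division by it to divisibility over the integers; as a divisor of the monic
  \<open>h\<close> it is monic up to sign.\<close>

lemma minimal_int_poly:
  assumes h: "lead_coeff h = 1" "ieval h z = 0"
  obtains g where "lead_coeff g = 1" "ieval g z = 0" "\<And>f. ieval f z = 0 \<Longrightarrow> g dvd f"
proof -
  define P where "P f \<longleftrightarrow> f \<noteq> 0 \<and> ieval f z = 0" for f
  have "P h" using h by (auto simp: P_def)
  then obtain g0 where g0: "P g0" "\<And>f. degree f < degree g0 \<Longrightarrow> \<not> P f"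
    using exists_least_iff[of "\<lambda>d. \<exists>f. P f \<and> degree f = d"] by (metis (mono_tags))
  define g1 where "g1 = primitive_part g0"
  have g0_eq: "g0 = smult (content g0) g1" by (simp add: g1_def)
  have g1: "g1 \<noteq> 0" "content g1 = 1" "degree g1 = degree g0"
    using g0(1) by (auto simp: g1_def P_def)
  have "of_int (content g0) * ieval g1 z = 0"
    using g0(1) g0_eq by (metis P_def ieval_smult)
  then have g1z: "ieval g1 z = 0" using g0(1) by (auto simp: P_def)
  have dvd: "g1 dvd f" if f: "ieval f z = 0" for f
  proof -
    obtain a q where aq: "a \<noteq> 0" "smult a f = g1 * q + pseudo_mod f g1"
      using pseudo_mod(1)[OF g1(1), of f] by blast
    have "ieval (pseudo_mod f g1) z = ieval (smult a f - g1 * q) z" using aq by simp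
    also have "\<dots> = 0" using f g1z by simp
    finally have "pseudo_mod f g1 = 0"
      using pseudo_mod(2)[OF g1(1), of f] g0(2)[of "pseudo_mod f g1"] g1(3) by (auto simp: P_def)
    then have eq: "smult a f = g1 * q" using aq by simp
    \<comment> \<open>Since \<open>g1\<close> is primitive, the factor \<open>a\<close> introduced
      by pseudo-division divides the content of \<open>q\<close> and cancels.\<close>
    then have "content (smult a f) = content q" using g1(2) by (simp add: content_mult)
    then have "a dvd content q" by (metis content_smult dvd_triv_left normalize_dvd_iff dvd_mult2)
    then have "[:a:] dvd q" by (simp add: const_poly_dvd_iff_dvd_content)
    then obtain q' where "q = smult a q'" by (auto elim: dvdE)
    then have "smult a f = smult a (g1 * q')" using eq by simp
    then have "f = g1 * q'" by (rule smult_cancel[OF aq(1)])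
    then show ?thesis by simp
  qed
  have "g1 dvd h" using dvd h by simp
  then have "lead_coeff g1 dvd 1" using h(1) by (metis dvdE dvd_triv_left lead_coeff_mult)
  then have lc: "lead_coeff g1 = 1 \<or> lead_coeff g1 = -1" by auto
  define g where "g = smult (lead_coeff g1) g1"
  have "lead_coeff g = 1" "ieval g z = 0" using lc g1z by (auto simp: g_def)
  moreover have "g dvd f" if "ieval f z = 0" for f
    using dvd[OF that] lc by (auto simp: g_def)
  ultimately show thesis using that by blast
qed

text \<open>Reducing a supposed inverse \<open>w\<close> modulo the monic minimal polynomial
  \<open>g\<close> leaves \<open>r\<close> with \<open>q r - 1\<close> vanishing at \<open>z\<close>
  but of degree below that of \<open>g\<close>. So it is zero, and its constant coefficient makes
  \<open>q\<close> divide 1.\<close>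

lemma prime_not_invertible:
  assumes h: "lead_coeff h = 1" "ieval h z = 0" and q: "Factorial_Ring.prime q"
  shows "of_nat q * ieval w z \<noteq> 1"
proof
  assume eq: "of_nat q * ieval w z = 1"
  obtain g where g: "lead_coeff g = 1" "ieval g z = 0" "\<And>f. ieval f z = 0 \<Longrightarrow> g dvd f"
    using minimal_int_poly[OF h] by blast
  have g0: "g \<noteq> 0" using g by auto
  have deg: "degree g > 0"
  proof (rule ccontr)
    assume "\<not> degree g > 0"
    then obtain c where "g = [:c:]" using degree_eq_zeroE by blast
    then show False using g by simp
  qed
  define r where "r = pseudo_mod w g"
  \<comment> \<open>Pseudo-division by a monic polynomial is ordinary division, the scaling factor
    being a power of 1.\<close>
  obtain s where w: "w = g * s + r"
  proof -
    obtain q r' where qr: "pseudo_divmod w g = (q, r')" by fastforce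
    have "smult (lead_coeff g ^ (Suc (degree w) - degree g)) w = g * q + r'"
      using pseudo_divmod(1)[OF g0 qr] by simp
    then have "w = g * q + r" using g(1) qr by (simp add: r_def pseudo_mod_def)
    then show thesis by (rule that)
  qed
  have rdeg: "degree r < degree g"
    using pseudo_mod(2)[OF g0, of w] deg by (auto simp: r_def)
  have "ieval (smult (int q) r - 1) z = 0"
    using eq w g(2) by simp
  then have "g dvd smult (int q) r - 1" by (rule g(3))
  moreover have "degree (smult (int q) r - 1) < degree g"
    using rdeg deg by (intro degree_diff_less) auto
  ultimately have "smult (int q) r - 1 = 0"
    by (metis dvd_imp_degree_le not_le)
  then have "coeff (smult (int q) r) 0 = 1" by simp
  then have "int q dvd 1" by (metis coeff_smult dvd_triv_left)
  then show False using q by simp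
qed

text \<open>Dedekind's argument. Write \<open>X\<^sup>N - 1 = g k\<close> with \<open>g\<close> the minimal polynomial of \<open>z\<close>. If
  \<open>g(z\<^sup>q) \<noteq> 0\<close> then \<open>k(z\<^sup>q) = 0\<close>, and differentiating shows that \<open>g(z\<^sup>q)\<close> divides \<open>N\<close> in \<open>\<int>[z]\<close>. But
  \<open>g(z\<^sup>q) \<equiv> g(z)\<^sup>q = 0\<close> modulo \<open>q\<close>, so \<open>q\<close> would be invertible in \<open>\<int>[z]\<close>.\<close>

theorem ieval_power_prime:
  assumes N: "N > 0" and z: "z ^ N = 1" and f: "ieval f z = 0"
    and q: "Factorial_Ring.prime q" "\<not> q dvd N"
  shows "ieval f (z ^ q) = 0"
proof -
  define h :: "int poly" where "h = monom 1 N - 1"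
  have hz: "ieval h z = 0" using z by (simp add: h_def)
  have lh: "lead_coeff h = 1"
  proof -
    have "degree h = N" unfolding h_def
      by (rule antisym[OF degree_le]) (use N in \<open>auto simp: coeff_eq_0 le_degree\<close>)
    then show ?thesis using N by (simp add: h_def)
  qed
  obtain g where g: "ieval g z = 0" "\<And>f. ieval f z = 0 \<Longrightarrow> g dvd f"
    using minimal_int_poly[OF lh hz] by blast
  have "ieval g (z ^ q) = 0"
  proof (rule ccontr)
    assume ne: "ieval g (z ^ q) \<noteq> 0"
    obtain k where k: "h = g * k" using g(2)[OF hz] by blast
    have "ieval h (z ^ q) = 0" using z by (simp add: h_def flip: power_mult)
      (simp add: power_mult mult.commute)
    then have kz: "ieval k (z ^ q) = 0" using ne k by simp
    have "pderiv h = monom (int N) (N - 1)" by (simp add: h_def pderiv_diff pderiv_monom)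
    then have "monom (int N) (N - 1) = g * pderiv k + k * pderiv g" using k by (simp add: pderiv_mult)
    then have "ieval (monom (int N) (N - 1)) (z ^ q)
        = ieval (g * pderiv k + k * pderiv g) (z ^ q)" by simp
    then have eq: "of_nat N * (z ^ q) ^ (N - 1) = ieval g (z ^ q) * ieval (pderiv k) (z ^ q)"
      using kz by simp
    obtain w where "pcompose g (monom 1 q) = g ^ q + smult (int q) w"
      using pcompose_monom_prime[OF q(1)] by blast
    then have "ieval (pcompose g (monom 1 q)) z = ieval (g ^ q + smult (int q) w) z" by simp
    then have gq: "ieval g (z ^ q) = of_nat q * ieval w z"
      using g(1) q(1) by (simp add: prime_gt_0_nat)
    \<comment> \<open>The factor \<open>monom 1 q\<close> has value \<open>z ^ q\<close> and
      completes \<open>(z ^ q) ^ (N - 1)\<close> to 1. Thus \<open>q\<close> times the value of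
      \<open>u\<close> is \<open>N\<close>, and Bezout turns this into an inverse of
      \<open>q\<close>.\<close>
    define u where "u = w * pcompose (pderiv k) (monom 1 q) * monom 1 q"
    have "(z ^ q) ^ (N - 1) * z ^ q = (z ^ q) ^ N" using N by (metis power_minus_mult)
    also have "\<dots> = 1" using z by (metis mult.commute power_mult power_one)
    finally have one: "(z ^ q) ^ (N - 1) * z ^ q = 1" .
    have "of_nat q * ieval u z = of_nat N * ((z ^ q) ^ (N - 1) * z ^ q)"
      using eq gq by (simp add: u_def algebra_simps)
    then have u: "of_nat q * ieval u z = of_nat N" using one by simp
    have "coprime (int q) (int N)" using q by (simp add: prime_imp_coprime)
    then obtain a b where ab: "a * int q + b * int N = 1"
      using bezout_int[of "int q" "int N"] by (metis coprime_iff_gcd_eq_1)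
    have "of_nat q * ieval ([:a:] + smult b u) z = of_int a * of_nat q + of_int b * (of_nat q * ieval u z)"
      by (simp add: algebra_simps)
    also have "\<dots> = of_int (a * int q + b * int N)" unfolding u by simp
    also have "\<dots> = 1" by (simp add: ab)
    finally show False using prime_not_invertible[OF lh hz q(1)] by blast
  qed
  moreover obtain l where "f = g * l" using g(2)[OF f] by blast
  ultimately show ?thesis by simp
qed

text \<open>Prime factors of \<open>j\<close> are split off one by one; each intermediate power of
  \<open>z\<close> is again an \<open>N\<close>-th root of unity, so
  \<open>ieval_power_prime\<close> applies to it.\<close>

theorem ieval_power_coprime:
  assumes N: "N > 0" and z: "z ^ N = 1" and f: "ieval f z = 0" and j: "coprime j N" "j > 0"
  shows "ieval f (z ^ j) = 0"
  using j(2,1)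
proof (induction j rule: prime_divisors_induct)
  case zero
  then show ?case by simp
next
  case (unit x)
  then show ?case using f by simp
next
  case (factor q x)
  have x: "coprime q N" "coprime x N" using factor.prems(2) by auto
  have "(z ^ x) ^ N = 1" using z by (metis mult.commute power_mult power_one)
  moreover have "\<not> q dvd N" using x(1) factor.hyps
    by (meson coprime_common_divisor dvd_refl not_prime_unit)
  moreover have "ieval f (z ^ x) = 0" using factor x by simp
  ultimately have "ieval f ((z ^ x) ^ q) = 0"
    using ieval_power_prime[OF N] factor.hyps(1) by blast
  then show ?case by (simp add: mult.commute flip: power_mult)
qed

subsection \<open>Fourier transforms of sets\<close>

definition unity_root :: "nat \<Rightarrow> int \<Rightarrow> complex" where
  "unity_root N k = exp (2 * of_real pi * \<i> * of_int k / of_nat N)"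

lemma unity_root_cis: "unity_root N k = cis (2 * pi * of_int k / of_nat N)"
  by (simp add: unity_root_def cis_conv_exp mult_ac)

lemma unity_root_0 [simp]: "unity_root N 0 = 1"
  by (simp add: unity_root_def)

lemma unity_root_add: "unity_root N (k + l) = unity_root N k * unity_root N l"
  by (simp add: unity_root_def ring_distribs add_divide_distrib flip: exp_add)

lemma unity_root_mult_nat: "unity_root N (k * int j) = unity_root N k ^ j"
  by (induction j) (simp_all add: ring_distribs unity_root_add)

lemma cnj_unity_root: "cnj (unity_root N k) = unity_root N (- k)"
  by (simp add: unity_root_cis cis_cnj)

lemma unity_root_eq_1_iff:
  assumes "N > 0"
  shows "unity_root N k = 1 \<longleftrightarrow> int N dvd k"
proof
  assume "unity_root N k = 1"
  then have "cos (2 * pi * of_int k / of_nat N) = 1"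
    by (metis unity_root_cis cis.sel(1) one_complex.sel(1))
  then obtain j :: int where "2 * pi * of_int k / of_nat N = of_int j * 2 * pi"
    using cos_one_2pi_int by blast
  then have "of_int k = (of_int j * of_nat N :: real)" using assms by (simp add: field_simps)
  then have "k = j * int N" by (metis of_int_eq_iff of_int_mult of_int_of_nat_eq)
  then show "int N dvd k" by simp
next
  assume "int N dvd k"
  then obtain j where "k = int N * j" by blast
  then have "2 * pi * of_int k / of_nat N = 2 * pi * of_int j" using assms by simp
  then show "unity_root N k = 1" using cis_multiple_2pi[of "of_int j"] by (simp add: unity_root_cis)
qed

lemma unity_root_cong:
  assumes "[k = l] (mod int N)" "N > 0"
  shows "unity_root N k = unity_root N l"
proof -
  have "unity_root N (k - l) = 1"
    using assms by (simp add: unity_root_eq_1_iff cong_iff_dvd_diff)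
  then show ?thesis using unity_root_add[of N "k - l" l] by simp
qed

lemma unity_root_mult_cancel:
  assumes "M > 0"
  shows "unity_root (M * N) (int M * k) = unity_root N k"
  using assms by (simp add: unity_root_def mult_ac)

lemma sum_unity_root:
  assumes "N > 0"
  shows "(\<Sum>s<N. unity_root N (k * int s)) = (if int N dvd k then of_nat N else 0)"
proof (cases "int N dvd k")
  case True
  then have "unity_root N (k * int s) = 1" for s
    using assms by (simp add: unity_root_eq_1_iff)
  then show ?thesis using True by simp
next
  case False
  then have "unity_root N k \<noteq> 1" using assms by (simp add: unity_root_eq_1_iff)
  moreover have "unity_root N k ^ N = 1"
    using assms by (simp add: unity_root_eq_1_iff flip: unity_root_mult_nat)
  ultimately show ?thesis using False by (simp add: unity_root_mult_nat geometric_sum)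
qed

text \<open>The modulus is independent of the range of \<open>A\<close>: for representatives of a
  subset of the group of order \<open>n * p\<close>, \<open>dft n A\<close> is the transform of the
  projection to order \<open>n\<close>, counted with multiplicity.\<close>

definition dft :: "nat \<Rightarrow> int set \<Rightarrow> int \<Rightarrow> complex" where
  "dft N A k = (\<Sum>a\<in>A. unity_root N (k * a))"

lemma dft_cong:
  assumes "[k = l] (mod int N)" "N > 0"
  shows "dft N A k = dft N A l"
  unfolding dft_def by (intro sum.cong refl unity_root_cong cong_mult assms cong_refl)

lemma dft_0 [simp]: "dft N A 0 = of_nat (card A)"
  by (simp add: dft_def)

lemma dft_mult_cancel: "M > 0 \<Longrightarrow> dft (M * N) A (int M * k) = dft N A k"
  by (simp add: dft_def mult.assoc unity_root_mult_cancel)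

lemma dft_eq_ieval:
  assumes "A \<subseteq> {0..}"
  shows "dft N A k = ieval (\<Sum>a\<in>A. monom 1 (nat a)) (unity_root N k)"
proof -
  have "unity_root N (k * a) = unity_root N k ^ nat a" if "a \<in> A" for a
    using that assms unity_root_mult_nat[of N k "nat a"] by auto
  then show ?thesis by (simp add: dft_def)
qed

text \<open>Galois invariance of the zero set: the coefficient is the mask polynomial of
  \<open>A\<close> at a root of unity, and multiplying the frequency by a unit replaces that root by
  a coprime power.\<close>

lemma dft_eq_0_mult_coprime:
  assumes N: "N > 0" and A: "A \<subseteq> {0..}" and zero: "dft N A k = 0"
    and j: "coprime j (int N)"
  shows "dft N A (k * j) = 0"
proof -
  \<comment> \<open>The summand \<open>N\<close> keeps the exponent positive even when
    \<open>j\<close> is 0 modulo \<open>N\<close>, as may happen for \<open>N = 1\<close>.\<close>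
  define j' where "j' = nat (j mod int N) + N"
  have j': "[int j' = j] (mod int N)"
    using N by (simp add: j'_def cong_def)
  have "coprime (int j') (int N)" using cong_imp_coprime[OF cong_sym[OF j'] j] .
  then have cop: "coprime j' N" by simp
  have "unity_root N k ^ N = 1"
    using N by (simp add: unity_root_eq_1_iff flip: unity_root_mult_nat)
  then have "ieval (\<Sum>a\<in>A. monom 1 (nat a)) (unity_root N k ^ j') = 0"
    using zero N cop dft_eq_ieval[OF A, of N k] by (intro ieval_power_coprime[OF N]) (simp_all add: j'_def)
  then have "dft N A (k * int j') = 0"
    by (simp add: dft_eq_ieval[OF A] unity_root_mult_nat)
  then show ?thesis
    using dft_cong[OF cong_mult[OF cong_refl j'] N, of A k] by simp
qed

text \<open>Conjugation spreads the zero at \<open>k\<close> to all frequencies that are congruent to \<open>k\<close> modulo \<open>n\<close>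
  and prime to \<open>p\<close>; Fourier inversion on \<open>\<int>\<^sub>p\<close> then isolates one section.\<close>

lemma dft_prime_section:
  assumes n: "n > 0" and p: "Factorial_Ring.prime p" "coprime n p"
    and A: "finite A" "A \<subseteq> {0..}"
    and zero: "dft (n * p) A k = 0" and k: "\<not> int p dvd k"
    and m: "[int p * m = k] (mod int n)"
  shows "of_nat p * dft n {a \<in> A. [a = t] (mod int p)} m = dft n A m"
proof -
  have p0: "p > 0" using p(1) by (simp add: prime_gt_0_nat)
  have pp: "Factorial_Ring.prime (int p)" using p(1) by simp
  have cop: "coprime (int n) (int p)" using p(2) by simp
  have np: "n * p > 0" using n p0 by simp
  have vanish: "dft (n * p) A (int p * m + int n * s) = 0" if s: "\<not> int p dvd s" for s
  proof -
    let ?k = "int p * m + int n * s"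
    have kp: "coprime k (int p)" using k pp by (metis coprime_commute prime_imp_coprime)
    have sp: "coprime s (int p)" using s pp by (metis coprime_commute prime_imp_coprime)
    \<comment> \<open>The aim is a unit \<open>j\<close> modulo \<open>n * p\<close> with
      \<open>k * j\<close> congruent to \<open>?k\<close>: it is 1 modulo \<open>n\<close>, where
      the two frequencies agree, and their quotient modulo \<open>p\<close>.\<close>
    obtain i where i: "[k * i = 1] (mod int p)" using cong_solve_coprime_int[OF kp] by blast
    obtain j where j: "[j = 1] (mod int n)" "[j = ?k * i] (mod int p)"
      using binary_chinese_remainder_int[OF cop] by blast
    have "[k * j = k * 1] (mod int n)" using j(1) by (intro cong_mult cong_refl)
    also have "[k * 1 = ?k] (mod int n)"
      using cong_add[OF cong_sym[OF m], of 0 "int n * s"] by (simp add: cong_def)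
    finally have 1: "[k * j = ?k] (mod int n)" .
    have "[k * j = k * (?k * i)] (mod int p)" using j(2) by (intro cong_mult cong_refl)
    also have "k * (?k * i) = ?k * (k * i)" by simp
    also have "[?k * (k * i) = ?k * 1] (mod int p)" using i by (intro cong_mult cong_refl)
    finally have 2: "[k * j = ?k] (mod int p)" by simp
    have kj: "[k * j = ?k] (mod int (n * p))"
      using coprime_cong_mult[OF 1 2 cop] by simp
    have "coprime j (int n)" using cong_imp_coprime[OF cong_sym[OF j(1)]] by simp
    moreover have "coprime j (int p)"
    proof -
      have "coprime ?k (int p)"
      proof -
        have "coprime (int n * s) (int p)" using cop sp by simp
        then show ?thesis using gcd_add_mult[of "int p" m "int n * s"]
          by (simp add: coprime_iff_gcd_eq_1 gcd.commute mult.commute)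
      qed
      moreover have "coprime i (int p)"
        using cong_imp_coprime[OF cong_sym[OF i]] by simp
      ultimately show ?thesis using cong_imp_coprime[OF cong_sym[OF j(2)]] by simp
    qed
    ultimately have "coprime j (int (n * p))" by simp
    then have "dft (n * p) A (k * j) = 0" by (rule dft_eq_0_mult_coprime[OF np A(2) zero])
    then show ?thesis using dft_cong[OF kj np, of A] by simp
  qed
  \<comment> \<open>The frequency \<open>p m + n s\<close> is the character \<open>m\<close> modulo
    \<open>n\<close> times the character \<open>s\<close> modulo \<open>p\<close>.\<close>
  have split: "unity_root (n * p) ((int p * m + int n * s) * a)
      = unity_root n (m * a) * unity_root p (s * a)" for s a
  proof -
    have "(int p * m + int n * s) * a = int p * (m * a) + int n * (s * a)"
      by (simp add: algebra_simps)
    then show ?thesis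
      using unity_root_mult_cancel[OF p0, of n "m * a"] unity_root_mult_cancel[OF n, of p "s * a"]
      by (simp add: unity_root_add mult.commute)
  qed
  have G: "dft (n * p) A (int p * m + int n * s)
      = (\<Sum>a\<in>A. unity_root n (m * a) * unity_root p (s * a))" for s
    by (simp add: dft_def split)
  \<comment> \<open>Fourier inversion modulo \<open>p\<close>: by \<open>vanish\<close> only
    \<open>s = 0\<close> contributes, while the character sum over \<open>s\<close> selects the
    \<open>a\<close> congruent to \<open>t\<close>.\<close>
  have "dft n A m = (\<Sum>s<p. if s = 0 then dft n A m else 0)"
    using p0 by simp
  also have "\<dots> = (\<Sum>s<p. dft (n * p) A (int p * m + int n * int s) * unity_root p (- (t * int s)))"
  proof (rule sum.cong[OF refl])
    fix s assume s: "s \<in> {..<p}"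
    show "(if s = 0 then dft n A m else 0)
      = dft (n * p) A (int p * m + int n * int s) * unity_root p (- (t * int s))"
    proof (cases "s = 0")
      case True
      then show ?thesis using dft_mult_cancel[OF p0, of n A m] by (simp add: mult.commute)
    next
      case False
      then have "\<not> int p dvd int s" using s by (auto dest: dvd_imp_le)
      then show ?thesis using False vanish by simp
    qed
  qed
  also have "\<dots> = (\<Sum>s<p. \<Sum>a\<in>A. unity_root n (m * a) * unity_root p ((a - t) * int s))"
  proof (rule sum.cong[OF refl])
    fix s
    have "unity_root p (int s * a) * unity_root p (- (t * int s)) = unity_root p ((a - t) * int s)" for a
      by (simp add: algebra_simps flip: unity_root_add)
    then show "dft (n * p) A (int p * m + int n * int s) * unity_root p (- (t * int s))
      = (\<Sum>a\<in>A. unity_root n (m * a) * unity_root p ((a - t) * int s))"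
      by (simp add: G sum_distrib_right mult.assoc)
  qed
  also have "\<dots> = (\<Sum>a\<in>A. \<Sum>s<p. unity_root n (m * a) * unity_root p ((a - t) * int s))"
    by (rule sum.swap)
  also have "\<dots> = (\<Sum>a\<in>A. if [a = t] (mod int p) then of_nat p * unity_root n (m * a) else 0)"
    by (intro sum.cong refl)
      (simp add: sum_unity_root[OF p0] cong_iff_dvd_diff flip: sum_distrib_left)
  also have "\<dots> = of_nat p * dft n {a \<in> A. [a = t] (mod int p)} m"
    using A(1) by (auto simp: dft_def sum_distrib_left sum.inter_filter intro!: sum.cong)
  finally show ?thesis by simp
qed

section \<open>Spectra and their duality\<close>

definition pairwise_dft_zero :: "nat \<Rightarrow> int set \<Rightarrow> int set \<Rightarrow> bool" where
  "pairwise_dft_zero N A L \<longleftrightarrow> (\<forall>l\<in>L. \<forall>l'\<in>L. l \<noteq> l' \<longrightarrow> dft N A (l - l') = 0)"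

lemma is_spectrum_iff:
  "is_spectrum N A L \<longleftrightarrow> L \<subseteq> carrier (cyclic N) \<and> card L = card A \<and> pairwise_dft_zero N A L"
  by (simp add: is_spectrum_def pairwise_dft_zero_def dft_def unity_root_def mult.assoc)

lemma norm_dft_sq:
  "complex_of_real ((norm (dft N A k))\<^sup>2) = (\<Sum>a\<in>A. \<Sum>a'\<in>A. unity_root N (k * (a - a')))"
proof -
  have "complex_of_real ((norm (dft N A k))\<^sup>2) = dft N A k * cnj (dft N A k)"
    by (rule complex_norm_square)
  also have "\<dots> = (\<Sum>a\<in>A. \<Sum>a'\<in>A. unity_root N (k * a) * unity_root N (- (k * a')))"
    by (simp add: dft_def cnj_unity_root sum_product)
  also have "\<dots> = (\<Sum>a\<in>A. \<Sum>a'\<in>A. unity_root N (k * (a - a')))"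
    by (intro sum.cong refl) (simp add: algebra_simps flip: unity_root_add)
  finally show ?thesis .
qed

text \<open>By \<open>norm_dft_sq\<close> either side expands to the sum of
  \<open>unity_root N ((l - l') * (a - a'))\<close> over all quadruples, which is symmetric in
  \<open>A\<close> and \<open>L\<close>.\<close>

lemma sum_norm_dft_swap:
  "(\<Sum>l\<in>L. \<Sum>l'\<in>L. (norm (dft N A (l - l')))\<^sup>2) = (\<Sum>a\<in>A. \<Sum>a'\<in>A. (norm (dft N L (a - a')))\<^sup>2)"
proof -
  have "complex_of_real (\<Sum>l\<in>L. \<Sum>l'\<in>L. (norm (dft N A (l - l')))\<^sup>2)
      = (\<Sum>l\<in>L. \<Sum>l'\<in>L. \<Sum>a\<in>A. \<Sum>a'\<in>A. unity_root N ((l - l') * (a - a')))"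
    by (simp only: of_real_sum norm_dft_sq)
  also have "\<dots> = (\<Sum>l\<in>L. \<Sum>a\<in>A. \<Sum>l'\<in>L. \<Sum>a'\<in>A. unity_root N ((l - l') * (a - a')))"
    by ((rule sum.cong[OF refl])+, rule sum.swap)
  also have "\<dots> = (\<Sum>a\<in>A. \<Sum>l\<in>L. \<Sum>l'\<in>L. \<Sum>a'\<in>A. unity_root N ((l - l') * (a - a')))"
    by (rule sum.swap)
  also have "\<dots> = (\<Sum>a\<in>A. \<Sum>l\<in>L. \<Sum>a'\<in>A. \<Sum>l'\<in>L. unity_root N ((l - l') * (a - a')))"
    by ((rule sum.cong[OF refl])+, rule sum.swap)
  also have "\<dots> = (\<Sum>a\<in>A. \<Sum>a'\<in>A. \<Sum>l\<in>L. \<Sum>l'\<in>L. unity_root N ((l - l') * (a - a')))"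
    by ((rule sum.cong[OF refl])+, rule sum.swap)
  also have "\<dots> = complex_of_real (\<Sum>a\<in>A. \<Sum>a'\<in>A. (norm (dft N L (a - a')))\<^sup>2)"
    unfolding of_real_sum norm_dft_sq by (intro sum.cong refl) (simp add: mult.commute)
  finally show ?thesis by (simp only: of_real_eq_iff)
qed

text \<open>Both sides of \<open>sum_norm_dft_swap\<close> equal \<open>|A|\<^sup>3\<close>, which the diagonal terms on the right
  already exhaust.\<close>

lemma pairwise_dft_zero_swap:
  assumes fin: "finite A" "finite L" and card: "card L = card A" and L: "pairwise_dft_zero N A L"
  shows "pairwise_dft_zero N L A"
proof -
  let ?f = "\<lambda>a a'. (norm (dft N L (a - a')))\<^sup>2"
  have "(\<Sum>a\<in>A. \<Sum>a'\<in>A. ?f a a') = (\<Sum>l\<in>L. \<Sum>l'\<in>L. (norm (dft N A (l - l')))\<^sup>2)"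
    by (rule sum_norm_dft_swap[symmetric])
  also have "\<dots> = (\<Sum>l\<in>L. \<Sum>l'\<in>L. if l = l' then (real (card A))\<^sup>2 else 0)"
    using L by (intro sum.cong refl) (auto simp: pairwise_dft_zero_def)
  also have "\<dots> = real (card A) * (real (card A))\<^sup>2"
    using fin card by simp
  finally have total: "(\<Sum>a\<in>A. \<Sum>a'\<in>A. ?f a a') = real (card A) * (real (card A))\<^sup>2" .
  have "(\<Sum>a\<in>A. \<Sum>a'\<in>A. ?f a a') = (\<Sum>a\<in>A. (real (card A))\<^sup>2 + (\<Sum>a'\<in>A - {a}. ?f a a'))"
    using fin card by (intro sum.cong refl) (simp add: sum.remove)
  also have "\<dots> = real (card A) * (real (card A))\<^sup>2 + (\<Sum>a\<in>A. \<Sum>a'\<in>A - {a}. ?f a a')"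
    by (simp add: sum.distrib)
  finally have "(\<Sum>a\<in>A. \<Sum>a'\<in>A - {a}. ?f a a') = 0" using total by simp
  then have "\<forall>a\<in>A. (\<Sum>a'\<in>A - {a}. ?f a a') = 0"
    using fin by (subst (asm) sum_nonneg_eq_0_iff) (auto intro: sum_nonneg)
  then have "\<forall>a\<in>A. \<forall>a'\<in>A - {a}. ?f a a' = 0"
    using fin by (subst (asm) sum_nonneg_eq_0_iff) auto
  then show ?thesis by (auto simp: pairwise_dft_zero_def)
qed

subsection \<open>Tilings of cyclic groups of square-free order\<close>

text \<open>Orthogonality leaves \<open>n\<close> times the sum of the coefficients of
  \<open>P\<close> at exponents congruent to \<open>- g\<close> modulo \<open>n\<close>. It makes
  the Frobenius error term in \<open>tiling_dilate_prime\<close> integral.\<close>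

lemma sum_ieval_unity_root:
  assumes "n > 0"
  shows "\<exists>c::int. (\<Sum>k<n. ieval P (unity_root n (int k)) * unity_root n (g * int k)) = of_nat n * of_int c"
proof (induction P arbitrary: g)
  case 0
  show ?case by (intro exI[of _ 0]) simp
next
  case (pCons a P)
  obtain c where c: "(\<Sum>k<n. ieval P (unity_root n (int k)) * unity_root n ((g + 1) * int k)) = of_nat n * of_int c"
    using pCons.IH by blast
  have "(\<Sum>k<n. ieval (pCons a P) (unity_root n (int k)) * unity_root n (g * int k))
      = of_int a * (\<Sum>k<n. unity_root n (g * int k))
        + (\<Sum>k<n. ieval P (unity_root n (int k)) * unity_root n ((g + 1) * int k))"
    by (simp add: ring_distribs sum.distrib sum_distrib_left unity_root_add mult_ac)
  also have "\<dots> = of_nat n * of_int ((if int n dvd g then a else 0) + c)"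
    unfolding c by (simp add: sum_unity_root[OF assms] ring_distribs)
  finally show ?case by blast
qed

text \<open>Frobenius gives \<open>A(X) B(X\<^sup>q) \<equiv> A(X) B(X)\<^sup>q\<close> modulo \<open>q\<close>. Modulo \<open>X\<^sup>n - 1\<close> the right-hand side is
  \<open>|B|\<^sup>q\<^sup>-\<^sup>1 (1 + X + \<dots> + X\<^sup>n\<^sup>-\<^sup>1)\<close>, so every residue is represented a number of times prime to \<open>q\<close>.
  The coefficients modulo \<open>X\<^sup>n - 1\<close> are read off from the values at the \<open>n\<close>-th roots of unity.\<close>

lemma tiling_dilate_prime:
  fixes A :: "int set" and B :: "'b set" and f :: "'b \<Rightarrow> int"
  assumes n: "n > 0" and fin: "finite A" "finite B" and nonneg: "A \<subseteq> {0..}" "\<And>b. b \<in> B \<Longrightarrow> f b \<ge> 0"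
    and bij: "bij_betw (\<lambda>(a, b). (a + f b) mod int n) (A \<times> B) {0..<int n}"
    and q: "Factorial_Ring.prime q" "\<not> q dvd card B"
  shows "bij_betw (\<lambda>(a, b). (a + int q * f b) mod int n) (A \<times> B) {0..<int n}"
proof -
  define u where "u = unity_root n"
  define P where "P = (\<Sum>b\<in>B. monom 1 (nat (f b)) :: int poly)"
  define Q where "Q = (\<Sum>a\<in>A. monom 1 (nat a) :: int poly)"
  have q0: "q > 0" using q(1) by (simp add: prime_gt_0_nat)
  have Q: "ieval Q (u k) = (\<Sum>a\<in>A. u (k * a))" for k
    using dft_eq_ieval[OF nonneg(1), of n k] by (simp add: dft_def Q_def u_def)
  have Pj: "ieval P (u k ^ j) = (\<Sum>b\<in>B. u (k * (int j * f b)))" for k j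
  proof -
    have "u (k * (int j * f b)) = (u k ^ j) ^ nat (f b)" if "b \<in> B" for b
      using nonneg(2)[OF that] unity_root_mult_nat[of n "k" "j * nat (f b)"]
      by (simp add: u_def power_mult)
    then show ?thesis by (simp add: P_def)
  qed
  \<comment> \<open>In Fourier terms, the tiling says that the product of the two mask polynomials
    vanishes at all non-trivial \<open>n\<close>-th roots of unity.\<close>
  have PQ: "ieval Q (u (int k)) * ieval P (u (int k)) = (if k = 0 then of_nat n else 0)" if "k < n" for k
  proof -
    have "ieval Q (u (int k)) * ieval P (u (int k)) = (\<Sum>(a, b)\<in>A \<times> B. u (int k * (a + f b)))"
      unfolding Q Pj[of "int k" 1, simplified] sum_product sum.cartesian_product
      by (simp add: u_def unity_root_add ring_distribs case_prod_beta)
    also have "\<dots> = (\<Sum>(a, b)\<in>A \<times> B. u (int k * ((a + f b) mod int n)))"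
      unfolding u_def using n by (intro sum.cong refl) (auto intro!: unity_root_cong cong_mult simp: cong_def)
    also have "\<dots> = (\<Sum>x\<in>{0..<int n}. u (int k * x))"
      using sum.reindex_bij_betw[OF bij, of "\<lambda>x. u (int k * x)"] by (simp add: case_prod_beta)
    also have "\<dots> = (\<Sum>x<n. u (int k * int x))"
      by (rule sum.reindex_bij_witness[of _ int nat]) auto
    also have "\<dots> = (if int n dvd int k then of_nat n else 0)"
      unfolding u_def by (rule sum_unity_root[OF n])
    finally show ?thesis using that by (auto dest: dvd_imp_le)
  qed
  obtain w where w: "pcompose P (monom 1 q) = P ^ q + smult (int q) w"
    using pcompose_monom_prime[OF q(1)] by blast
  have Pq: "ieval P (z ^ q) = ieval P z ^ q + of_nat q * ieval w z" for z
    using arg_cong[OF w, of "\<lambda>f. ieval f z"] by simp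
  have P1: "ieval P (u 0) = of_nat (card B)" using Pj[of 0 1] by (simp add: u_def)
  have surj: "\<exists>x\<in>A \<times> B. (\<lambda>(a, b). (a + int q * f b) mod int n) x = g" if g: "g \<in> {0..<int n}" for g
  proof (rule ccontr)
    assume none: "\<not> ?thesis"
    obtain c :: int where c: "(\<Sum>k<n. ieval (Q * w) (u (int k)) * u ((- g) * int k)) = of_nat n * of_int c"
      using sum_ieval_unity_root[OF n] unfolding u_def by blast
    \<comment> \<open>This inverse transform is \<open>n\<close> times the number of representations
      of \<open>g\<close>, so 0 by assumption. Frobenius evaluates it a second time, as
      \<open>n |B|^(q-1)\<close> plus an integer multiple of \<open>n q\<close>.\<close>
    have "(\<Sum>k<n. ieval Q (u (int k)) * ieval P (u (int k) ^ q) * u (- g * int k))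
        = (\<Sum>k<n. \<Sum>(a, b)\<in>A \<times> B. u ((a + int q * f b - g) * int k))"
    proof (rule sum.cong[OF refl])
      fix k
      have "u (int k * a) * u (int k * (int q * f b)) * u (- g * int k)
          = u ((a + int q * f b - g) * int k)" for a b
        unfolding u_def unity_root_add[symmetric] by (simp add: algebra_simps)
      then show "ieval Q (u (int k)) * ieval P (u (int k) ^ q) * u (- g * int k)
          = (\<Sum>(a, b)\<in>A \<times> B. u ((a + int q * f b - g) * int k))"
        unfolding Q Pj unfolding sum_product unfolding sum_distrib_right sum.cartesian_product
        by (simp only: case_prod_unfold)
    qed
    also have "\<dots> = (\<Sum>(a, b)\<in>A \<times> B. \<Sum>k<n. u ((a + int q * f b - g) * int k))"
      by (simp add: case_prod_beta) (rule sum.swap)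
    also have "\<dots> = (\<Sum>(a, b)\<in>A \<times> B. 0)"
    proof (intro sum.cong refl, clarify)
      fix a b assume ab: "a \<in> A" "b \<in> B"
      have "\<not> int n dvd a + int q * f b - g"
      proof
        assume "int n dvd a + int q * f b - g"
        then have "(a + int q * f b) mod int n = g mod int n" by (simp add: mod_eq_dvd_iff)
        then show False using none ab g by force
      qed
      then show "(\<Sum>k<n. u ((a + int q * f b - g) * int k)) = 0"
        unfolding u_def by (simp add: sum_unity_root[OF n])
    qed
    finally have "0 = (\<Sum>k<n. ieval Q (u (int k)) * ieval P (u (int k) ^ q) * u (- g * int k))"
      by simp
    also have "\<dots> = (\<Sum>k<n. (if k = 0 then of_nat n * of_nat (card B) ^ (q - 1) else 0)
        + of_nat q * (ieval (Q * w) (u (int k)) * u ((- g) * int k)))"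
    proof (rule sum.cong[OF refl])
      fix k assume k: "k \<in> {..<n}"
      have "ieval Q (u (int k)) * ieval P (u (int k)) ^ q
          = ieval Q (u (int k)) * ieval P (u (int k)) * ieval P (u (int k)) ^ (q - 1)"
        using q0 by (simp flip: power_Suc)
      also have "\<dots> = (if k = 0 then of_nat n * of_nat (card B) ^ (q - 1) else 0)"
        using PQ k P1 by auto
      finally have 1: "ieval Q (u (int k)) * ieval P (u (int k)) ^ q
        = (if k = 0 then of_nat n * of_nat (card B) ^ (q - 1) else 0)" .
      have "ieval Q (u (int k)) * ieval P (u (int k) ^ q) * u (- g * int k)
        = ieval Q (u (int k)) * ieval P (u (int k)) ^ q * u (- g * int k)
          + of_nat q * (ieval (Q * w) (u (int k)) * u ((- g) * int k))"
        by (simp add: Pq algebra_simps)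
      also have "ieval Q (u (int k)) * ieval P (u (int k)) ^ q * u (- g * int k)
        = (if k = 0 then of_nat n * of_nat (card B) ^ (q - 1) else 0)"
        unfolding 1 by (simp add: u_def)
      finally show "ieval Q (u (int k)) * ieval P (u (int k) ^ q) * u (- g * int k)
        = (if k = 0 then of_nat n * of_nat (card B) ^ (q - 1) else 0)
          + of_nat q * (ieval (Q * w) (u (int k)) * u ((- g) * int k))" .
    qed
    also have "\<dots> = of_nat n * of_nat (card B) ^ (q - 1) + of_nat q * (of_nat n * of_int c)"
      using n by (simp only: sum.distrib c flip: sum_distrib_left) simp
    finally have "of_nat n * (of_nat (card B) ^ (q - 1) + of_nat q * of_int c :: complex) = 0"
      by (simp add: algebra_simps)
    then have "of_int (int (card B) ^ (q - 1) + int q * c) = (0 :: complex)" using n by simp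
    then have "int (card B) ^ (q - 1) + int q * c = 0" by (simp only: of_int_eq_0_iff)
    then have "int q dvd int (card B) ^ (q - 1)"
      by (metis dvd_add_left_iff dvd_0_right dvd_triv_left)
    then have "q dvd card B" using q(1) by (metis int_dvd_int_iff of_nat_power prime_dvd_power)
    then show False using q(2) by contradiction
  qed
  let ?h = "\<lambda>(a, b). (a + int q * f b) mod int n"
  have img: "?h ` (A \<times> B) = {0..<int n}"
  proof
    show "?h ` (A \<times> B) \<subseteq> {0..<int n}" using n by auto
    show "{0..<int n} \<subseteq> ?h ` (A \<times> B)" using surj unfolding image_def by blast
  qed
  have "card (A \<times> B) = card {0..<int n}" by (rule bij_betw_same_card[OF bij])
  then have "inj_on ?h (A \<times> B)"
    using img fin by (intro eq_card_imp_inj_on) (simp_all only: finite_cartesian_product)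
  with img show ?thesis by (simp add: bij_betw_def)
qed

text \<open>One prime factor of \<open>K\<close> is treated at a time. The map \<open>f\<close> of
  \<open>tiling_dilate_prime\<close> carries the dilations already made, so that the index set
  \<open>B\<close> and its size stay fixed.\<close>

lemma tiling_dilate:
  fixes A B :: "int set"
  assumes n: "n > 0" and fin: "finite A" "finite B" and nonneg: "A \<subseteq> {0..}" "B \<subseteq> {0..}"
    and bij: "bij_betw (\<lambda>(a, b). (a + b) mod int n) (A \<times> B) {0..<int n}"
    and K: "K > 0" "coprime K (card B)"
  shows "bij_betw (\<lambda>(a, b). (a + int K * b) mod int n) (A \<times> B) {0..<int n}"
  using K
proof (induction K rule: prime_divisors_induct)
  case zero
  then show ?case by simp
next
  case (unit x)
  then show ?case using bij by simp
next
  case (factor q x)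
  have "coprime q (card B)" using factor.prems(2) by simp
  then have "\<not> q dvd card B"
    using factor.hyps by (meson coprime_common_divisor dvd_refl not_prime_unit)
  then have "bij_betw (\<lambda>(a, b). (a + int q * (int x * b)) mod int n) (A \<times> B) {0..<int n}"
    using factor nonneg
    by (intro tiling_dilate_prime[OF n fin, where q = q]) auto
  then show ?case by (simp add: mult.assoc)
qed

section \<open>Tiles of square-free cyclic groups are transversals\<close>

lemma tiles_cyclic_bij:
  assumes n: "n > 0" and "tiles (cyclic n) A"
  obtains B where "B \<subseteq> {0..<int n}" "bij_betw (\<lambda>(a, b). (a + b) mod int n) (A \<times> B) {0..<int n}"
proof -
  obtain B where B: "B \<subseteq> {0..<int n}"
    and ex1: "\<And>g. g \<in> {0..<int n} \<Longrightarrow> \<exists>!z. z \<in> A \<times> B \<and> g = (fst z + snd z) mod int n"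
    using assms by (auto simp: tiles_def carrier_integer_mod_group)
  let ?h = "\<lambda>(a, b). (a + b) mod int n"
  have range: "?h z \<in> {0..<int n}" for z using n by (simp add: case_prod_beta)
  have "inj_on ?h (A \<times> B)"
  proof (rule inj_onI)
    fix z z' assume z: "z \<in> A \<times> B" "z' \<in> A \<times> B" and eq: "?h z = ?h z'"
    have "?h z = (fst z + snd z) mod int n" "?h z = (fst z' + snd z') mod int n"
      using eq by (simp_all add: case_prod_beta)
    then show "z = z'" using ex1[OF range[of z]] z by blast
  qed
  moreover have "?h ` (A \<times> B) = {0..<int n}"
  proof
    show "?h ` (A \<times> B) \<subseteq> {0..<int n}" using range by blast
    show "{0..<int n} \<subseteq> ?h ` (A \<times> B)"
    proof
      fix g assume "g \<in> {0..<int n}"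
      then obtain z where "z \<in> A \<times> B" "g = (fst z + snd z) mod int n" using ex1 by blast
      then show "g \<in> ?h ` (A \<times> B)" by (intro image_eqI[of _ _ z]) (simp_all add: case_prod_beta)
    qed
  qed
  ultimately show thesis using that B by (simp add: bij_betw_def)
qed

lemma squarefree_mult_imp_coprime:
  fixes a b :: nat
  assumes "squarefree (a * b)"
  shows "coprime a b"
proof (rule coprimeI)
  fix d assume "d dvd a" "d dvd b"
  then have "d ^ 2 dvd a * b" by (simp add: power2_eq_square mult_dvd_mono)
  then show "is_unit d" using assms by (simp add: squarefree_def)
qed

text \<open>Dilating the complement by \<open>|A|\<close> turns it into the subgroup of multiples of \<open>|A|\<close>.\<close>

lemma tile_squarefree_transversal:
  assumes n: "n > 0" "squarefree n" and tile: "tiles (cyclic n) A"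
  shows "card A dvd n" "bij_betw (\<lambda>a. a mod int (card A)) A {0..<int (card A)}"
proof -
  have A: "A \<subseteq> {0..<int n}" using tile n by (simp add: tiles_def carrier_integer_mod_group)
  obtain B where B: "B \<subseteq> {0..<int n}"
    and bij: "bij_betw (\<lambda>(a, b). (a + b) mod int n) (A \<times> B) {0..<int n}"
    using tiles_cyclic_bij[OF n(1) tile] by blast
  define m where "m = card A"
  have fin: "finite A" "finite B" using A B by (auto intro: finite_subset)
  have nm: "n = m * card B"
    using bij_betw_same_card[OF bij] by (simp add: card_cartesian_product m_def)
  then show dvd: "card A dvd n" by (simp add: m_def)
  have m0: "m > 0" using nm n(1) by (cases m) auto
  \<comment> \<open>Square-freeness makes the sizes of the two factors coprime, which permits the
    dilation by \<open>m\<close>.\<close>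
  have "coprime m (card B)" using n(2) nm squarefree_mult_imp_coprime by simp
  then have bij': "bij_betw (\<lambda>(a, b). (a + int m * b) mod int n) (A \<times> B) {0..<int n}"
    using A B by (intro tiling_dilate[OF n(1) fin _ _ bij m0]) auto
  \<comment> \<open>Modulo \<open>m\<close> the dilated summand disappears, so \<open>A\<close>
    alone covers all residues.\<close>
  have img: "(\<lambda>a. a mod int m) ` A = {0..<int m}"
  proof
    show "(\<lambda>a. a mod int m) ` A \<subseteq> {0..<int m}" using m0 by auto
    show "{0..<int m} \<subseteq> (\<lambda>a. a mod int m) ` A"
    proof
      fix y assume y: "y \<in> {0..<int m}"
      have "m \<le> n" using dvd n(1) by (simp add: m_def dvd_imp_le)
      then have "y \<in> {0..<int n}" using y by auto
      then obtain a b where ab: "a \<in> A" "y = (a + int m * b) mod int n"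
        using bij_betw_imp_surj_on[OF bij'] by fastforce
      have "y = y mod int m" using y by simp
      also have "\<dots> = (a + int m * b) mod int m"
        unfolding ab(2) using dvd by (simp add: mod_mod_cancel m_def)
      finally show "y \<in> (\<lambda>a. a mod int m) ` A" using ab(1) by simp
    qed
  qed
  have "inj_on (\<lambda>a. a mod int m) A"
    using fin(1) by (rule eq_card_imp_inj_on) (simp only: img, simp add: m_def)
  then show "bij_betw (\<lambda>a. a mod int (card A)) A {0..<int (card A)}"
    using img by (simp add: bij_betw_def m_def)
qed

subsection \<open>Products with a cyclic group of prime order\<close>

text \<open>\<open>A\<close> is a graph over its projection: the first coordinate fixes the point of
  \<open>A\<close> and the point of \<open>B\<close>, and the full second factor corrects the other
  coordinate.\<close>

lemma prod_tiles_if_inj_fst: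
  assumes n: "n > 0" and p: "p > 0" and A: "A \<subseteq> carrier (cyclic n \<times>\<times> cyclic p)"
    and inj: "inj_on fst A" and tile: "tiles (cyclic n) (fst ` A)"
  shows "tiles (cyclic n \<times>\<times> cyclic p) A"
proof -
  obtain B where B: "B \<subseteq> {0..<int n}"
    and ex1: "\<And>g. g \<in> {0..<int n} \<Longrightarrow> \<exists>!z. z \<in> fst ` A \<times> B \<and> g = (fst z + snd z) mod int n"
    using tile n by (auto simp: tiles_def carrier_integer_mod_group)
  have "\<exists>!z. z \<in> A \<times> (B \<times> {0..<int p}) \<and> g = fst z \<otimes>\<^bsub>cyclic n \<times>\<times> cyclic p\<^esub> snd z"
    if g: "g \<in> carrier (cyclic n \<times>\<times> cyclic p)" for g
  proof -
    obtain x t where xt: "g = (x, t)" "x \<in> {0..<int n}" "t \<in> {0..<int p}"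
      using g n p by (auto simp: carrier_integer_mod_group)
    obtain z0 where z0: "z0 \<in> fst ` A \<times> B" "x = (fst z0 + snd z0) mod int n"
      using ex1[OF xt(2)] by blast
    then obtain a b where ab: "a \<in> A" "b \<in> B" "x = (fst a + b) mod int n" by force
    define s where "s = (t - snd a) mod int p"
    have s: "s \<in> {0..<int p}" "(snd a + s) mod int p = t"
      using p xt(3) by (auto simp: s_def mod_add_right_eq)
    show ?thesis
    proof (rule ex1I[of _ "(a, (b, s))"])
      show "(a, (b, s)) \<in> A \<times> (B \<times> {0..<int p}) \<and>
          g = fst (a, (b, s)) \<otimes>\<^bsub>cyclic n \<times>\<times> cyclic p\<^esub> snd (a, (b, s))"
        using ab s xt by (simp add: mult_DirProd')
    next
      fix z assume z: "z \<in> A \<times> (B \<times> {0..<int p}) \<and> g = fst z \<otimes>\<^bsub>cyclic n \<times>\<times> cyclic p\<^esub> snd z"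
      obtain a' b' s' where z_eq: "z = (a', (b', s'))" by (metis surj_pair)
      have z': "a' \<in> A" "b' \<in> B" "s' \<in> {0..<int p}"
        "x = (fst a' + b') mod int n" "t = (snd a' + s') mod int p"
        using z xt(1) by (auto simp: z_eq mult_DirProd')
      have "(fst a, b) \<in> fst ` A \<times> B \<and> x = (fst (fst a, b) + snd (fst a, b)) mod int n"
        "(fst a', b') \<in> fst ` A \<times> B \<and> x = (fst (fst a', b') + snd (fst a', b')) mod int n"
        using ab z' by simp_all
      then have "(fst a, b) = (fst a', b')" using ex1[OF xt(2)] by blast
      then have *: "a' = a" "b' = b" using inj ab(1) z'(1) by (auto dest: inj_onD)
      have "[snd a + s' = snd a + s] (mod int p)"
        using z'(5) s(2) * by (simp add: cong_def)
      then have "[s' = s] (mod int p)" by (simp only: cong_add_lcancel)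
      then have "s' = s" using z'(3) s(1) by (simp add: cong_def)
      then show "z = (a, (b, s))" using z_eq * by simp
    qed
  qed
  then show ?thesis
    unfolding tiles_def using A B n p
    by (intro conjI exI[of _ "B \<times> {0..<int p}"]) (auto simp: carrier_integer_mod_group)
qed

text \<open>Every fibre is a transversal of the subgroup of multiples of \<open>m\<close>, so this
  subgroup, placed in the first factor, complements all fibres simultaneously.\<close>

lemma prod_tiles_if_transversal:
  assumes n: "n > 0" and p: "p > 0" and A: "A \<subseteq> carrier (cyclic n \<times>\<times> cyclic p)"
    and m: "m dvd n" and trans: "\<And>t. bij_betw (\<lambda>x. x mod int m) {x. (x, t mod int p) \<in> A} {0..<int m}"
  shows "tiles (cyclic n \<times>\<times> cyclic p) A"
proof -
  define B where "B = {h \<in> {0..<int n}. int m dvd h}"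
  have m0: "m > 0" using m n by (cases m) auto
  have "\<exists>!z. z \<in> A \<times> (B \<times> {0}) \<and> g = fst z \<otimes>\<^bsub>cyclic n \<times>\<times> cyclic p\<^esub> snd z"
    if g: "g \<in> carrier (cyclic n \<times>\<times> cyclic p)" for g
  proof -
    obtain x t where xt: "g = (x, t)" "x \<in> {0..<int n}" "t \<in> {0..<int p}"
      using g n p by (auto simp: carrier_integer_mod_group)
    have t: "t mod int p = t" using xt(3) by simp
    have bij: "bij_betw (\<lambda>x. x mod int m) {x. (x, t) \<in> A} {0..<int m}"
      using trans[of t] by (simp only: t)
    have "x mod int m \<in> {0..<int m}" using m0 by simp
    then obtain a where a: "(a, t) \<in> A" "a mod int m = x mod int m"
      using bij_betw_imp_surj_on[OF bij] by (metis (mono_tags, lifting) imageE mem_Collect_eq)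
    define h where "h = (x - a) mod int n"
    have dvd: "int m dvd int n" using m by simp
    have "int m dvd x - a" using a(2) by (metis mod_eq_dvd_iff)
    then have h: "h \<in> B" using n dvd by (simp add: B_def h_def dvd_mod_iff)
    have xh: "x = (a + h) mod int n" using xt(2) by (simp add: h_def mod_add_right_eq)
    show ?thesis
    proof (rule ex1I[of _ "((a, t), (h, 0))"])
      show "((a, t), (h, 0)) \<in> A \<times> (B \<times> {0}) \<and>
          g = fst ((a, t), (h, 0)) \<otimes>\<^bsub>cyclic n \<times>\<times> cyclic p\<^esub> snd ((a, t), (h, 0))"
        using a h xh xt by simp
    next
      fix z assume z: "z \<in> A \<times> (B \<times> {0}) \<and> g = fst z \<otimes>\<^bsub>cyclic n \<times>\<times> cyclic p\<^esub> snd z"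
      obtain a' t' h' where z_eq: "z = ((a', t'), (h', 0))" using z by auto
      have z': "(a', t') \<in> A" "h' \<in> B" "x = (a' + h') mod int n" "t = t' mod int p"
        using z xt(1) by (auto simp: z_eq)
      have "t' \<in> {0..<int p}" using z'(1) A p by (auto simp: carrier_integer_mod_group)
      then have t': "t' = t" using z'(4) by simp
      have "x mod int m = (a' + h') mod int m" unfolding z'(3) using dvd by (simp add: mod_mod_cancel)
      also have "\<dots> = a' mod int m" using z'(2) by (auto simp: B_def elim!: dvdE)
      finally have "a' = a"
        using bij a z'(1) t' by (auto simp: bij_betw_def dest: inj_onD)
      moreover from this have "[a + h' = a + h] (mod int n)"
        using z'(3) xh by (simp add: cong_def)
      then have "[h' = h] (mod int n)" by (simp only: cong_add_lcancel)
      then have "h' = h" using z'(2) h by (simp add: cong_def B_def)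
      ultimately show "z = ((a, t), (h, 0))" using z_eq t' by simp
    qed
  qed
  moreover have "B \<times> {0} \<subseteq> carrier (cyclic n \<times>\<times> cyclic p)"
    using n p by (auto simp: carrier_integer_mod_group B_def)
  ultimately show ?thesis unfolding tiles_def
    by (intro conjI exI[of _ "B \<times> {0}"] ballI A)
qed

text \<open>A frequency \<open>p m\<close> modulo \<open>n p\<close> acts as \<open>m\<close> modulo
  \<open>n\<close>, so the spectrum is \<open>M\<close> multiplied by the inverse \<open>v\<close>
  of \<open>p\<close> modulo \<open>n\<close>.\<close>

lemma spectral_mod:
  assumes n: "n > 0" and p: "coprime n p"
    and S: "finite S" "S \<noteq> {}" "inj_on (\<lambda>x. x mod int n) S" and M: "card M = card S"
    and zero: "\<And>l l' m. \<lbrakk>l \<in> M; l' \<in> M; l \<noteq> l'; [int p * m = l - l'] (mod int n)\<rbrakk> \<Longrightarrow> dft n S m = 0"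
  shows "spectral n ((\<lambda>x. x mod int n) ` S)"
proof -
  let ?S = "(\<lambda>x. x mod int n) ` S"
  have dft: "dft n ?S k = dft n S k" for k
  proof -
    have "dft n ?S k = (\<Sum>a\<in>S. unity_root n (k * (a mod int n)))"
      using S(3) by (simp add: dft_def sum.reindex)
    also have "\<dots> = dft n S k"
      unfolding dft_def using n by (intro sum.cong refl unity_root_cong) (auto simp: cong_def mod_mult_right_eq)
    finally show ?thesis .
  qed
  have "coprime (int p) (int n)" using p by (simp add: coprime_commute)
  then obtain v where v: "[int p * v = 1] (mod int n)" using cong_solve_coprime_int by blast
  define L where "L = (\<lambda>l. (v * l) mod int n) ` M"
  have vl: "[int p * (v * l) = l] (mod int n)" for l
    using cong_mult[OF v cong_refl[of l]] by (simp add: mult.assoc)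
  have diff: "dft n S ((v * l) mod int n - (v * l') mod int n) = 0"
    if "l \<in> M" "l' \<in> M" "l \<noteq> l'" for l l'
  proof -
    have "[int p * (v * l - v * l') = l - l'] (mod int n)"
      using cong_diff[OF vl[of l] vl[of l']] by (simp add: right_diff_distrib)
    then have "dft n S (v * l - v * l') = 0" by (rule zero[OF that])
    moreover have "[(v * l) mod int n - (v * l') mod int n = v * l - v * l'] (mod int n)"
      by (simp add: cong_def mod_diff_eq)
    ultimately show ?thesis using dft_cong n by metis
  qed
  \<comment> \<open>A collision would give a zero at frequency 0, where the coefficient is the size
    of \<open>S\<close>.\<close>
  have "inj_on (\<lambda>l. (v * l) mod int n) M"
  proof (rule inj_onI, rule ccontr)
    fix l l' assume "l \<in> M" "l' \<in> M" "(v * l) mod int n = (v * l') mod int n" "l \<noteq> l'"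
    then have "dft n S 0 = 0" using diff[of l l'] by simp
    then show False using S by simp
  qed
  then have "card L = card ?S" using M S(3) by (simp add: L_def card_image)
  moreover have "L \<subseteq> carrier (cyclic n)"
    using n by (auto simp: L_def carrier_integer_mod_group)
  moreover have "pairwise_dft_zero n ?S L"
    unfolding pairwise_dft_zero_def L_def dft using diff by blast
  ultimately have "is_spectrum n ?S L" by (simp add: is_spectrum_iff)
  then show ?thesis using S(2) n by (auto simp: spectral_def carrier_integer_mod_group)
qed

text \<open>If \<open>p\<close> divides \<open>k\<close>, the coefficient is already one modulo
  \<open>n\<close>. Otherwise \<open>dft_prime_section\<close> is applied to an empty section, which
  exists because \<open>A\<close> has fewer than \<open>p\<close> elements.\<close>

lemma dft_projection_eq_0:
  assumes n: "n > 0" and p: "Factorial_Ring.prime p" "coprime n p"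
    and A: "finite A" "A \<subseteq> {0..}" "card A < p"
    and zero: "dft (n * p) A k = 0" and m: "[int p * m = k] (mod int n)"
  shows "dft n A m = 0"
proof (cases "int p dvd k")
  case True
  have p0: "p > 0" using p(1) by (simp add: prime_gt_0_nat)
  from True obtain m' where m': "k = int p * m'" by blast
  have "coprime (int p) (int n)" using p(2) by (simp add: coprime_commute)
  then have "[m = m'] (mod int n)" using m unfolding m' by (simp add: cong_mult_lcancel)
  then have "dft n A m = dft n A m'" using n by (rule dft_cong)
  then show ?thesis using zero dft_mult_cancel[OF p0, of n A m'] by (simp add: m' mult.commute)
next
  case False
  have "card ((\<lambda>a. a mod int p) ` A) < card {0..<int p}"
    using card_image_le[OF A(1), of "\<lambda>a. a mod int p"] A(3) by simp
  then obtain t where t: "t \<in> {0..<int p}" "t \<notin> (\<lambda>a. a mod int p) ` A"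
    using card_mono[of "(\<lambda>a. a mod int p) ` A" "{0..<int p}"] A(1) by (metis finite_imageI not_le subsetI)
  then have "{a \<in> A. [a = t] (mod int p)} = {}" by (auto simp: cong_def)
  then have "dft n {a \<in> A. [a = t] (mod int p)} m = 0" by (simp only: dft_def sum.empty)
  then show ?thesis
    using dft_prime_section[OF n p A(1,2) zero False m, of t] by simp
qed

text \<open>Two points of \<open>L\<close> congruent modulo \<open>n\<close> would force the
  coefficient of \<open>A\<close> at 0, its size, to vanish.\<close>

lemma inj_on_mod_if_card_less:
  assumes n: "n > 0" and p: "Factorial_Ring.prime p" "coprime n p"
    and A: "finite A" "A \<subseteq> {0..}" "card A < p" "A \<noteq> {}"
    and L: "pairwise_dft_zero (n * p) A L"
  shows "inj_on (\<lambda>x. x mod int n) L"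
proof (rule inj_onI, rule ccontr)
  fix l l' assume l: "l \<in> L" "l' \<in> L" "l mod int n = l' mod int n" "l \<noteq> l'"
  then have "[int p * 0 = l - l'] (mod int n)"
    by (simp add: cong_iff_dvd_diff mod_eq_dvd_iff dvd_diff_commute)
  then have "dft n A 0 = 0"
    using L l by (intro dft_projection_eq_0[OF n p A(1-3), of "l - l'"]) (auto simp: pairwise_dft_zero_def)
  then show False using A by simp
qed

text \<open>By pigeonhole two points of \<open>L\<close> agree modulo \<open>n\<close>, hence differ
  modulo \<open>p\<close>. Their difference has component 0 modulo \<open>n\<close>, and the
  coefficient of a section at 0 is its size.\<close>

lemma card_section_if_card_gt:
  assumes n: "n > 0" and p: "Factorial_Ring.prime p" "coprime n p"
    and A: "finite A" "A \<subseteq> {0..}" and L: "pairwise_dft_zero (n * p) A L"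
    and L': "L \<subseteq> {0..<int (n * p)}" "card L > n"
  shows "p * card {a \<in> A. [a = t] (mod int p)} = card A"
proof -
  have "card ((\<lambda>x. x mod int n) ` L) \<le> card {0..<int n}"
    using n by (intro card_mono) auto
  then have "\<not> inj_on (\<lambda>x. x mod int n) L" using L'(2) by (auto dest: card_image)
  then obtain l l' where l: "l \<in> L" "l' \<in> L" "l \<noteq> l'" "l mod int n = l' mod int n"
    by (auto simp: inj_on_def)
  have dvd: "int n dvd l - l'" using l(4) by (simp add: mod_eq_dvd_iff)
  have "\<not> int p dvd l - l'"
  proof
    assume "int p dvd l - l'"
    with dvd have "int n * int p dvd l - l'" using p(2) by (intro divides_mult) auto
    then have "l mod int (n * p) = l' mod int (n * p)" by (simp add: mod_eq_dvd_iff)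
    then show False using l L'(1) by (auto simp: subset_iff)
  qed
  moreover have "[int p * 0 = l - l'] (mod int n)"
    using dvd by (simp add: cong_iff_dvd_diff dvd_diff_commute)
  moreover have "dft (n * p) A (l - l') = 0" using L l by (simp add: pairwise_dft_zero_def)
  ultimately have "of_nat p * dft n {a \<in> A. [a = t] (mod int p)} 0 = dft n A 0"
    by (intro dft_prime_section[OF n p A])
  then show ?thesis by (simp flip: of_nat_mult)
qed

text \<open>Otherwise each of the \<open>p\<close> classes contains a point alone in its class
  modulo \<open>n\<close>; such points have distinct residues modulo \<open>n\<close>, contradicting
  \<open>p > n\<close>.\<close>

lemma exists_section_without_isolated:
  assumes n: "n > 0" and p: "p > n"
  obtains k where "\<And>l. \<lbrakk>l \<in> L; [l = k] (mod int p)\<rbrakk> \<Longrightarrow> \<exists>l''\<in>L. l'' \<noteq> l \<and> [l'' = l] (mod int n)"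
proof (rule ccontr)
  assume none: "\<not> thesis"
  have "\<exists>l. l \<in> L \<and> [l = k] (mod int p) \<and> (\<forall>l''\<in>L. [l'' = l] (mod int n) \<longrightarrow> l'' = l)" for k
    using none that[of k] by blast
  then obtain f where f: "\<And>k. f k \<in> L" "\<And>k. [f k = k] (mod int p)"
      "\<And>k l''. \<lbrakk>l'' \<in> L; [l'' = f k] (mod int n)\<rbrakk> \<Longrightarrow> l'' = f k"
    by metis
  have "inj_on (\<lambda>k. f k mod int n) {0..<int p}"
  proof (rule inj_onI)
    fix k k' assume k: "k \<in> {0..<int p}" "k' \<in> {0..<int p}" "f k mod int n = f k' mod int n"
    then have "f k = f k'" using f(1,3) by (simp add: cong_def)
    then have "[k = k'] (mod int p)" using f(2) by (metis cong_sym cong_trans)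
    then show "k = k'" using k by (simp add: cong_def)
  qed
  moreover have "(\<lambda>k. f k mod int n) ` {0..<int p} \<subseteq> {0..<int n}" using n by auto
  ultimately have "card {0..<int p} \<le> card {0..<int n}"
    by (intro card_inj_on_le) auto
  then show False using p by simp
qed

text \<open>The difference \<open>l - l'\<close> is divisible by \<open>p\<close> and only yields a
  zero of all of \<open>A\<close> at \<open>m\<close>. Replacing \<open>l\<close> by its twin
  \<open>l''\<close> keeps \<open>m\<close> but leaves the multiples of \<open>p\<close>, so
  \<open>dft_prime_section\<close> passes the zero on to each section.\<close>

lemma section_spectrum:
  assumes n: "n > 0" and p: "Factorial_Ring.prime p" "coprime n p"
    and A: "finite A" "A \<subseteq> {0..}" and L: "pairwise_dft_zero (n * p) A L" "L \<subseteq> {0..<int (n * p)}"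
    and twin: "\<And>l. \<lbrakk>l \<in> L; [l = k] (mod int p)\<rbrakk> \<Longrightarrow> \<exists>l''\<in>L. l'' \<noteq> l \<and> [l'' = l] (mod int n)"
    and l: "l \<in> L" "[l = k] (mod int p)" "l' \<in> L" "[l' = k] (mod int p)" "l \<noteq> l'"
    and m: "[int p * m = l - l'] (mod int n)"
  shows "dft n {a \<in> A. [a = t] (mod int p)} m = 0"
proof -
  have p0: "p > 0" using p(1) by (simp add: prime_gt_0_nat)
  obtain l'' where l'': "l'' \<in> L" "l'' \<noteq> l" "[l'' = l] (mod int n)" using twin l by blast
  have ll': "[l = l'] (mod int p)" using l(2,4) by (metis cong_sym cong_trans)
  \<comment> \<open>A twin in the same class modulo \<open>p\<close> would agree with
    \<open>l\<close> modulo \<open>n p\<close> and so equal it.\<close>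
  have ndvd: "\<not> int p dvd l'' - l'"
  proof
    assume "int p dvd l'' - l'"
    then have "[l'' = l'] (mod int p)" by (simp add: cong_iff_dvd_diff)
    then have "[l'' = l] (mod int p)" using ll' by (metis cong_sym cong_trans)
    then have "[l'' = l] (mod (int n * int p))"
      using l''(3) p(2) by (intro coprime_cong_mult) auto
    then show False using l''(1,2) l(1) L(2) by (auto simp: cong_def subset_iff)
  qed
  have "l'' \<noteq> l'" using ndvd by auto
  then have "dft (n * p) A (l'' - l') = 0"
    using L(1) l'' l by (simp add: pairwise_dft_zero_def)
  moreover have "[l - l' = l'' - l'] (mod int n)"
    using l''(3) by (intro cong_diff) (auto intro: cong_sym)
  then have "[int p * m = l'' - l'] (mod int n)" using m by (rule cong_trans[rotated])
  ultimately have "of_nat p * dft n {a \<in> A. [a = t] (mod int p)} m = dft n A m"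
    using ndvd by (intro dft_prime_section[OF n p A])
  moreover have "dft n A m = 0"
  proof -
    have "int p dvd l - l'" using ll' by (simp add: cong_iff_dvd_diff)
    then obtain m' where m': "l - l' = int p * m'" by blast
    have "coprime (int p) (int n)" using p(2) by (simp add: coprime_commute)
    then have "[m = m'] (mod int n)" using m unfolding m' by (simp add: cong_mult_lcancel)
    then have "dft n A m = dft n A m'" using n by (rule dft_cong)
    moreover have "dft (n * p) A (l - l') = 0" using L(1) l by (simp add: pairwise_dft_zero_def)
    ultimately show ?thesis
      using dft_mult_cancel[OF p0, of n A m'] by (simp add: m' mult.commute)
  qed
  ultimately show ?thesis using p0 by simp
qed

theorem theorem1p1:
  fixes n p :: nat
  assumes "n > 0" and "squarefree n"
    and "Factorial_Ring.prime p" and "p > n"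
    and "S_T (cyclic n) (spectral n)"
  shows "S_T (cyclic n \<times>\<times> cyclic p) (spectral_prod n p)"
  unfolding S_T_def
proof (intro allI impI)
  fix A0 assume A0: "A0 \<subseteq> carrier (cyclic n \<times>\<times> cyclic p)" and spec: "spectral_prod n p A0"
  note n = assms(1) and p = assms(3)
  have p0: "p > 0" using p by (simp add: prime_gt_0_nat)
  have "\<not> p dvd n" using n \<open>p > n\<close> by (auto dest: dvd_imp_le)
  then have cop: "coprime n p" using p by (metis coprime_commute prime_imp_coprime)
  have np: "n * p > 0" using n p0 by simp
  have tile: "tiles (cyclic n) S" if "spectral n S" for S
    using that assms(5) by (simp add: S_T_def spectral_def)
  define A where "A = {x \<in> carrier (cyclic (n * p)). crt n p x \<in> A0}"
  obtain L where A: "A \<noteq> {}" "A \<subseteq> {0..<int (n * p)}" and L: "is_spectrum (n * p) A L"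
  proof -
    have "spectral (n * p) A" using spec by (simp add: spectral_prod_def A_def)
    then show thesis using that np by (auto simp: spectral_def carrier_integer_mod_group)
  qed
  have L': "L \<subseteq> {0..<int (n * p)}" "card L = card A" "pairwise_dft_zero (n * p) A L"
    using L np by (auto simp: is_spectrum_iff carrier_integer_mod_group)
  have fin: "finite A" "finite L" using A(2) L'(1) by (auto intro: finite_subset)
  have nonneg: "A \<subseteq> {0..}" "L \<subseteq> {0..}" using A(2) L'(1) by auto
  \<comment> \<open>Duality allows the lemmas to be applied with \<open>A\<close> and
    \<open>L\<close> exchanged.\<close>
  have dual: "pairwise_dft_zero (n * p) L A"
    by (rule pairwise_dft_zero_swap[OF fin L'(2,3)])
  have bij: "bij_betw (crt n p) (carrier (cyclic (n * p))) (carrier (cyclic n \<times>\<times> cyclic p))"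
    using crt_iso[OF cop n p0] by (simp add: iso_def)
  have A0_eq: "A0 = crt n p ` A"
  proof
    show "crt n p ` A \<subseteq> A0" by (auto simp: A_def)
    show "A0 \<subseteq> crt n p ` A"
    proof
      fix y assume y: "y \<in> A0"
      then have "y \<in> crt n p ` carrier (cyclic (n * p))"
        using A0 bij_betw_imp_surj_on[OF bij] by auto
      then show "y \<in> crt n p ` A" using y by (auto simp: A_def)
    qed
  qed
  show "tiles (cyclic n \<times>\<times> cyclic p) A0"
  proof (cases "card A < p")
    case True
    \<comment> \<open>Here \<open>L\<close> is the set and \<open>A\<close> its spectrum, so that
      the projection of \<open>A\<close> becomes injective.\<close>
    have "card L < p" "L \<noteq> {}" using True L'(2) A(1) fin by (auto simp: card_eq_0_iff)
    then have inj: "inj_on (\<lambda>x. x mod int n) A"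
      using inj_on_mod_if_card_less[OF n p cop fin(2) nonneg(2) _ _ dual] by blast
    have "spectral n ((\<lambda>x. x mod int n) ` A)"
    proof (rule spectral_mod[OF n cop fin(1) A(1) inj L'(2)])
      fix l l' m assume "l \<in> L" "l' \<in> L" "l \<noteq> l'" and m: "[int p * m = l - l'] (mod int n)"
      then have "dft (n * p) A (l - l') = 0" using L'(3) by (simp add: pairwise_dft_zero_def)
      then show "dft n A m = 0"
        using m by (rule dft_projection_eq_0[OF n p cop fin(1) nonneg(1) True])
    qed
    moreover have "fst ` A0 = (\<lambda>x. x mod int n) ` A"
      by (simp add: A0_eq image_image crt_def)
    moreover have "inj_on fst A0"
      using inj by (auto simp: A0_eq inj_on_def crt_def)
    ultimately show ?thesis
      using tile by (intro prod_tiles_if_inj_fst[OF n p0 A0]) auto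
  next
    case False
    then have gt: "card A > n" "card L > n" using \<open>p > n\<close> L'(2) by auto
    define sec where "sec S t = {a \<in> S. [a = t] (mod int p)}" for S :: "int set" and t
    have cardA: "p * card (sec A t) = card A" for t
      unfolding sec_def by (rule card_section_if_card_gt[OF n p cop fin(1) nonneg(1) L'(3,1) gt(2)])
    \<comment> \<open>A section of \<open>L\<close> will serve as spectrum of the sections of
      \<open>A\<close>, so the sizes must match.\<close>
    have cardL: "p * card (sec L t) = card A" for t
      unfolding sec_def L'(2)[symmetric]
      by (rule card_section_if_card_gt[OF n p cop fin(2) nonneg(2) dual A(2) gt(1)])
    define m where "m = card (sec A 0)"
    have card_sec: "card (sec A t) = m" "card (sec L t) = m" for t
    proof -
      have "p * card (sec A t) = p * m" "p * card (sec L t) = p * m"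
        unfolding m_def cardA cardL by simp_all
      then show "card (sec A t) = m" "card (sec L t) = m" using p0 by simp_all
    qed
    have m0: "m > 0" using cardA[of 0] gt(1) by (cases m) (auto simp: m_def)
    obtain k where k: "\<And>l. \<lbrakk>l \<in> L; [l = k] (mod int p)\<rbrakk> \<Longrightarrow> \<exists>l''\<in>L. l'' \<noteq> l \<and> [l'' = l] (mod int n)"
      using exists_section_without_isolated[OF n \<open>p > n\<close>] by blast
    have tile_sec: "tiles (cyclic n) ((\<lambda>x. x mod int n) ` sec A t)"
      and card_image_sec: "card ((\<lambda>x. x mod int n) ` sec A t) = m" for t
    proof -
      have inj: "inj_on (\<lambda>x. x mod int n) (sec A t)"
      proof (rule inj_onI)
        fix a a' assume a: "a \<in> sec A t" "a' \<in> sec A t" "a mod int n = a' mod int n"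
        then have "[a = a'] (mod int n)" "[a = a'] (mod int p)"
          by (auto simp: sec_def cong_def)
        then have "[a = a'] (mod (int n * int p))" using cop by (intro coprime_cong_mult) auto
        then show "a = a'" using a A(2) by (auto simp: sec_def cong_def subset_iff)
      qed
      then show "card ((\<lambda>x. x mod int n) ` sec A t) = m" by (simp add: card_image card_sec)
      have sec: "finite (sec A t)" "sec A t \<noteq> {}"
        using card_sec(1)[of t] m0 card_gt_0_iff[of "sec A t"] by simp_all
      have "spectral n ((\<lambda>x. x mod int n) ` sec A t)"
      proof (rule spectral_mod[OF n cop sec inj])
        show "card (sec L k) = card (sec A t)" by (simp add: card_sec)
        fix l l' m assume "l \<in> sec L k" "l' \<in> sec L k" "l \<noteq> l'" "[int p * m = l - l'] (mod int n)"
        then show "dft n (sec A t) m = 0" unfolding sec_def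
          using section_spectrum[OF n p cop fin(1) nonneg(1) L'(3,1) k] by blast
      qed
      then show "tiles (cyclic n) ((\<lambda>x. x mod int n) ` sec A t)" by (rule tile)
    qed
    have fibre: "{x. (x, t mod int p) \<in> A0} = (\<lambda>x. x mod int n) ` sec A t" for t
      by (auto simp: A0_eq crt_def sec_def cong_def image_iff)
    show ?thesis
    proof (rule prod_tiles_if_transversal[OF n p0 A0])
      \<comment> \<open>Since \<open>m\<close> does not depend on \<open>t\<close>, one subgroup
        serves every fibre.\<close>
      show "m dvd n"
        using tile_squarefree_transversal(1)[OF n assms(2) tile_sec] by (simp add: card_image_sec)
      show "bij_betw (\<lambda>x. x mod int m) {x. (x, t mod int p) \<in> A0} {0..<int m}" for t
        using tile_squarefree_transversal(2)[OF n assms(2) tile_sec[of t]]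
        by (simp add: card_image_sec fibre)
    qed
  qed
qed

end
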